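(* (a) There exist a connected graph $G$, a constant capacity function $L$ and an integer $k$ such that LP1 for $(G,L,k)$ is feasible but $G^4$ admits no hard-capacitated $k$-center solution (so the integrality gap of LP1 for connected graphs with uniform hard capacities is at least $5$). (b) There exist a connected graph $G$, a constant capacity function $L$ and $k$ such that soft LP1 for $(G,L,k)$ is feasible but $G^3$ admits no soft-capacitated $k$-center solution (gap at least $4$ for uniform soft capacities). (c) There exist a connected graph $G$, a capacity function $L$ all of whose nonzero values are equal, and $k$ such that LP1 for $(G,L,k)$ is feasible but $G^6$ admits no hard-capacitated $k$-center solution (gap at least $7$ for non-uniform hard capacities).
   Context: $G=(V,E)$ undirected unweighted, $\mathrm{dist}_G$ shortest-path distance, $L:V\to\mathbb{N}$, $k$ a positive integer. LP1: variables $x_{u,v},y_u$ with (1) $\sum_u y_u=k$; (2) $x_{u,v}\le y_u$; (3) $\sum_v x_{u,v}\le L(u)y_u$; (4) $\sum_u x_{u,v}=1$; (5) $0\le y_u\le1$; (6) $x_{u,v}=0$ if $\mathrm{dist}_G(u,v)>1$; (7) $x_{u,v}\ge0$. Soft LP1 is LP1 with the upper bound $y_u\le 1$ removed. $G^\delta$ is the graph on $V$ with $uv$ an edge iff $\mathrm{dist}_G(u,v)\le\delta$. A hard-capacitated $k$-center solution in a graph $H$ on $V$: a set $S\subseteq V$, $|S|\le k$, and $\phi:V\to S$ with $\phi(v)=v$ or $\phi(v)v\in E(H)$, and $|\phi^{-1}(u)|\le L(u)$. A soft-capacitated $k$-center solution in $H$: $m:V\to\mathbb{Z}_{\ge0}$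 with $\sum m(u)\le k$ and $\phi:V\to V$ with $m(\phi(v))\ge1$, $\phi(v)=v$ or $\phi(v)v\in E(H)$, and $|\phi^{-1}(u)|\le L(u)m(u)$. *)

theory Defs
  imports Main "HOL-Library.Extended_Nat"
begin

definition graph :: "nat set \<Rightarrow> (nat \<Rightarrow> nat \<Rightarrow> bool) \<Rightarrow> bool" where
  "graph V E \<longleftrightarrow> finite V \<and> (\<forall>u v. E u v \<longrightarrow> u \<in> V \<and> v \<in> V)
     \<and> (\<forall>u v. E u v \<longrightarrow> E v u) \<and> (\<forall>u. \<not> E u u)"

definition walk :: "nat set \<Rightarrow> (nat \<Rightarrow> nat \<Rightarrow> bool) \<Rightarrow> nat list \<Rightarrow> bool" where
  "walk V E xs \<longleftrightarrow> xs \<noteq> [] \<and> set xs \<subseteq> V \<and>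
     (\<forall>i. Suc i < length xs \<longrightarrow> E (xs ! i) (xs ! Suc i))"

text \<open>Shortest-path distance (infinite if no walk exists).\<close>
definition gdist :: "nat set \<Rightarrow> (nat \<Rightarrow> nat \<Rightarrow> bool) \<Rightarrow> nat \<Rightarrow> nat \<Rightarrow> enat" where
  "gdist V E u v = (INF xs \<in> {xs. walk V E xs \<and> hd xs = u \<and> last xs = v}.
                      enat (length xs - 1))"

definition connected_graph :: "nat set \<Rightarrow> (nat \<Rightarrow> nat \<Rightarrow> bool) \<Rightarrow> bool" where
  "connected_graph V E \<longleftrightarrow> graph V E \<and> V \<noteq> {} \<and>
     (\<forall>u\<in>V. \<forall>v\<in>V. gdist V E u v < \<infinity>)"

definition gpow :: "nat set \<Rightarrow> (nat \<Rightarrow> nat \<Rightarrow> bool) \<Rightarrow> nat \<Rightarrow> nat \<Rightarrow> nat \<Rightarrow> bool" where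
  "gpow V E \<delta> u v \<longleftrightarrow> u \<in> V \<and> v \<in> V \<and> u \<noteq> v \<and> gdist V E u v \<le> enat \<delta>"

definition LP1_sol :: "bool \<Rightarrow> nat set \<Rightarrow> (nat \<Rightarrow> nat \<Rightarrow> bool) \<Rightarrow> (nat \<Rightarrow> nat) \<Rightarrow> nat
     \<Rightarrow> (nat \<Rightarrow> nat \<Rightarrow> real) \<Rightarrow> (nat \<Rightarrow> real) \<Rightarrow> bool" where
  "LP1_sol hard V E L k x y \<longleftrightarrow>
     (\<Sum>u\<in>V. y u) = real k \<and>
     (\<forall>u\<in>V. \<forall>v\<in>V. x u v \<le> y u) \<and>
     (\<forall>u\<in>V. (\<Sum>v\<in>V. x u v) \<le> real (L u) * y u) \<and>
     (\<forall>v\<in>V. (\<Sum>u\<in>V. x u v) = 1) \<and>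
     (\<forall>u\<in>V. 0 \<le> y u \<and> (hard \<longrightarrow> y u \<le> 1)) \<and>
     (\<forall>u\<in>V. \<forall>v\<in>V. gdist V E u v > 1 \<longrightarrow> x u v = 0) \<and>
     (\<forall>u\<in>V. \<forall>v\<in>V. 0 \<le> x u v)"

definition LP1_feasible :: "nat set \<Rightarrow> (nat \<Rightarrow> nat \<Rightarrow> bool) \<Rightarrow> (nat \<Rightarrow> nat) \<Rightarrow> nat \<Rightarrow> bool" where
  "LP1_feasible V E L k \<longleftrightarrow> (\<exists>x y. LP1_sol True V E L k x y)"

definition soft_LP1_feasible :: "nat set \<Rightarrow> (nat \<Rightarrow> nat \<Rightarrow> bool) \<Rightarrow> (nat \<Rightarrow> nat) \<Rightarrow> nat \<Rightarrow> bool" where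
  "soft_LP1_feasible V E L k \<longleftrightarrow> (\<exists>x y. LP1_sol False V E L k x y)"

definition hard_kcenter_sol :: "nat set \<Rightarrow> (nat \<Rightarrow> nat \<Rightarrow> bool) \<Rightarrow> (nat \<Rightarrow> nat) \<Rightarrow> nat \<Rightarrow> bool" where
  "hard_kcenter_sol V H L k \<longleftrightarrow> (\<exists>S \<phi>. S \<subseteq> V \<and> card S \<le> k \<and>
     (\<forall>v\<in>V. \<phi> v \<in> S \<and> (\<phi> v = v \<or> H (\<phi> v) v)) \<and>
     (\<forall>u\<in>S. card {v\<in>V. \<phi> v = u} \<le> L u))"

definition soft_kcenter_sol :: "nat set \<Rightarrow> (nat \<Rightarrow> nat \<Rightarrow> bool) \<Rightarrow> (nat \<Rightarrow> nat) \<Rightarrow> nat \<Rightarrow> bool" where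
  "soft_kcenter_sol V H L k \<longleftrightarrow> (\<exists>m \<phi>. (\<Sum>u\<in>V. m u) \<le> k \<and>
     (\<forall>v\<in>V. \<phi> v \<in> V \<and> m (\<phi> v) \<ge> 1 \<and> (\<phi> v = v \<or> H (\<phi> v) v)) \<and>
     (\<forall>u\<in>V. card {v\<in>V. \<phi> v = u} \<le> L u * m u))"

end

theory Submission
  imports Defs Complex_Main
begin

text \<open>One graph serves all three parts: six branches, each a clique whose 19 far clients have
  distance 4 from a common hub, with capacity 14 and \<open>k = 10\<close>. Fractionally, a branch uses
  opening \<open>3/2\<close> and the hub 1. Integrally, far clients of different branches are too far apart to
  share any facility except the hub, so a branch with only one facility of its own must send 5 far
  clients to the hub. The hub, of capacity 14, can thus relieve at most two branches, which makes at
  least 11 facilities necessary.\<close>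

section \<open>Walks and distances\<close>

lemma walk_Cons:
  assumes "walk V E xs" "u \<in> V" "E u (hd xs)"
  shows "walk V E (u # xs)"
  unfolding walk_def
proof (intro conjI allI impI)
  fix i assume "Suc i < length (u # xs)"
  then show "E ((u # xs) ! i) ((u # xs) ! Suc i)"
    using assms by (cases i) (auto simp: walk_def hd_conv_nth)
qed (use assms in \<open>auto simp: walk_def\<close>)

lemma gdist_le_walk:
  assumes "walk V E xs"
  shows "gdist V E (hd xs) (last xs) \<le> enat (length xs - 1)"
  unfolding gdist_def using assms by (intro INF_lower) auto

text \<open>The infimum of walk lengths is attained: if every walk from \<open>u\<close> to
  \<open>v\<close> were longer than \<open>d\<close>, then \<open>Suc d\<close> would be a lower
  bound for the infimum.\<close>

lemma gdist_le_enatE: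
  assumes "gdist V E u v \<le> enat d"
  obtains xs where "walk V E xs" "hd xs = u" "last xs = v" "length xs - 1 \<le> d"
proof -
  have "\<exists>xs. walk V E xs \<and> hd xs = u \<and> last xs = v \<and> length xs - 1 \<le> d"
  proof (rule ccontr)
    assume "\<not> ?thesis"
    then have "enat (Suc d) \<le> gdist V E u v"
      unfolding gdist_def by (intro INF_greatest) (auto simp: not_le)
    with assms have "enat (Suc d) \<le> enat d"
      by (rule order_trans[rotated])
    then show False by simp
  qed
  then show ?thesis using that by blast
qed

lemma gdist_adjacent_le_1:
  assumes "E u v" "u \<in> V" "v \<in> V"
  shows "gdist V E u v \<le> 1"
  using gdist_le_walk[of V E "[u, v]"] assms by (auto simp: walk_def one_enat_def)

lemma gdist_refl_le_1:
  assumes "u \<in> V"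
  shows "gdist V E u u \<le> 1"
  using gdist_le_walk[of V E "[u]"] assms by (auto simp: walk_def zero_enat_def[symmetric])

lemma walk_lipschitz:
  fixes f :: "nat \<Rightarrow> nat"
  assumes lip: "\<And>a b. E a b \<Longrightarrow> f a \<le> f b + 1" and "walk V E xs"
  shows "f (hd xs) \<le> f (last xs) + (length xs - 1)"
  using assms(2)
proof (induction xs rule: induct_list012)
  case (3 a b xs)
  have "walk V E (b # xs)"
    using 3(3) unfolding walk_def by fastforce
  then have "f b \<le> f (last (b # xs)) + length xs"
    using 3(2) by simp
  moreover have "E a b"
    using 3(3) unfolding walk_def by force
  ultimately show ?case using lip[of a b] by simp
qed (auto simp: walk_def)

text \<open>Source of all lower bounds on distance below: a potential that drops by at most 1 along
  each edge drops by at most \<open>d\<close> between vertices at distance at most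
  \<open>d\<close>.\<close>

lemma gdist_lipschitz:
  fixes f :: "nat \<Rightarrow> nat"
  assumes "\<And>a b. E a b \<Longrightarrow> f a \<le> f b + 1" "gdist V E u v \<le> enat d"
  shows "f u \<le> f v + d"
proof -
  obtain xs where xs: "walk V E xs" "hd xs = u" "last xs = v" "length xs - 1 \<le> d"
    using gdist_le_enatE[OF assms(2)] .
  have "f (hd xs) \<le> f (last xs) + (length xs - 1)"
    using walk_lipschitz[OF assms(1) xs(1)] .
  then show ?thesis using xs by simp
qed

lemma gdist_finite_rtranclp:
  assumes "graph V E" "E\<^sup>*\<^sup>* u v" "v \<in> V"
  shows "gdist V E u v < \<infinity>"
proof -
  have "\<exists>xs. walk V E xs \<and> hd xs = u \<and> last xs = v"
    using assms(2)
  proof (induction rule: converse_rtranclp_induct)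
    case base
    then show ?case using assms(3) by (intro exI[of _ "[v]"]) (auto simp: walk_def)
  next
    case (step a b)
    then obtain xs where xs: "walk V E xs" "hd xs = b" "last xs = v" by blast
    have "a \<in> V" using assms(1) step(1) by (auto simp: graph_def)
    then have "walk V E (a # xs)" using xs step(1) by (auto intro: walk_Cons)
    moreover have "xs \<noteq> []" using xs(1) by (auto simp: walk_def)
    ultimately show ?case using xs(3) by (intro exI[of _ "a # xs"]) auto
  qed
  then obtain xs where "walk V E xs" "hd xs = u" "last xs = v" by blast
  then have "gdist V E u v \<le> enat (length xs - 1)"
    using gdist_le_walk[of V E xs] by simp
  then show ?thesis by (rule le_less_trans) simp
qed

text \<open>Edges are symmetric, so a path to \<open>r\<close> can be reversed and any two vertices
  are joined through \<open>r\<close>.\<close>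

lemma connected_graph_root:
  assumes "graph V E" "r \<in> V" and reach: "\<And>v. v \<in> V \<Longrightarrow> E\<^sup>*\<^sup>* v r"
  shows "connected_graph V E"
proof -
  have "symp E" using assms(1) by (auto simp: graph_def symp_def)
  then have "E\<^sup>*\<^sup>* r v" if "v \<in> V" for v
    using reach[OF that] by (meson symp_rtranclp sympD)
  then have "gdist V E u v < \<infinity>" if "u \<in> V" "v \<in> V" for u v
    using gdist_finite_rtranclp[OF assms(1) _ that(2)] reach[OF that(1)] that(2)
    by (meson rtranclp_trans)
  then show ?thesis
    using assms(1,2) unfolding connected_graph_def by blast
qed

section \<open>The gap instance\<close>

definition gap_vertices :: "nat set" where
  "gap_vertices = {..132}"

text \<open>Vertex 132 is the hub. Branch \<open>i < 6\<close> consists of \<open>22 * i + j\<close> with \<open>j < 22\<close>: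
  a path from the hub through \<open>j = 0, 1, 2\<close>, and a clique on \<open>j = 2, \<dots>, 21\<close>. Only the hub
  has quotient 6 by 22.\<close>

definition gap_edge :: "nat \<Rightarrow> nat \<Rightarrow> bool" where
  "gap_edge u v \<longleftrightarrow> u \<le> 132 \<and> v \<le> 132 \<and> u \<noteq> v \<and>
     (u = 132 \<and> v mod 22 = 0 \<or> v = 132 \<and> u mod 22 = 0 \<or>
      u div 22 = v div 22 \<and>
        (u mod 22 \<ge> 2 \<and> v mod 22 \<ge> 2 \<or>
         v mod 22 = Suc (u mod 22) \<and> v mod 22 \<le> 2 \<or>
         u mod 22 = Suc (v mod 22) \<and> u mod 22 \<le> 2))"

text \<open>Capacity sits only where the fractional solution opens. In the sixth power this stops
  the vertices with j = 0 or j = 1 from serving other branches.\<close>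

definition gap_cap :: "nat \<Rightarrow> nat" where
  "gap_cap u = (if u = 132 \<or> u mod 22 = 2 \<or> u mod 22 = 3 then 14 else 0)"

definition gap_y :: "nat \<Rightarrow> real" where
  "gap_y u = (if u = 132 \<or> u mod 22 = 2 then 1 else if u mod 22 = 3 then 1/2 else 0)"

text \<open>The split 13/20, 7/20 exhausts both capacities: \<open>1 + 20 * 13/20 = 14\<close> and
  \<open>20 * 7/20 = 14 * 1/2\<close>.\<close>

definition gap_share :: "nat \<Rightarrow> nat \<Rightarrow> real" where
  "gap_share j j' =
     (if j = 2 then (if j' = 0 then 0 else if j' = 1 then 1 else 13/20)
      else if j = 3 \<and> 2 \<le> j' then 7/20 else 0)"

text \<open>The hub serves the six vertices with j = 0 and also itself, since 132 has remainder 0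
  modulo 22. All other clients are served inside their branch.\<close>

definition gap_x :: "nat \<Rightarrow> nat \<Rightarrow> real" where
  "gap_x u v =
     (if u = 132 then (if v mod 22 = 0 then 1 else 0)
      else if u div 22 = v div 22 then gap_share (u mod 22) (v mod 22) else 0)"

definition far_clients :: "nat \<Rightarrow> nat set" where
  "far_clients i = {22 * i + 3..<22 * i + 22}"

text \<open>On the vertices of the graph this is the distance to the hub; the cap 4 reflects the
  clique attached at j = 2.\<close>

definition depth :: "nat \<Rightarrow> nat" where
  "depth v = (if v = 132 then 0 else min 4 (Suc (v mod 22)))"

text \<open>For \<open>i < 6\<close>, the distance from a vertex \<open>v\<close> to the nearest far
  client of branch \<open>i\<close>. From outside the branch the route goes through the hub, which
  is 4 away.\<close>

definition far_dist :: "nat \<Rightarrow> nat \<Rightarrow> nat" where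
  "far_dist i v = (if v div 22 = i then 4 - depth v else 4 + depth v)"

lemma graph_gap: "graph gap_vertices gap_edge"
  unfolding graph_def gap_vertices_def gap_edge_def by auto

lemma gap_vertices_hub: "gap_vertices = insert 132 {..<132}"
  by (auto simp: gap_vertices_def)

lemma branch_vertex:
  fixes i j :: nat
  assumes "i < 6" "j < 22"
  shows "(22 * i + j) div 22 = i" "(22 * i + j) mod 22 = j"
    "22 * i + j \<noteq> 132"
  using assms by auto

lemma gap_vertex_cases:
  assumes "v \<in> gap_vertices"
  obtains "v = 132" | i j where "i < 6" "j < 22" "v = 22 * i + j"
proof (cases "v = 132")
  case False
  then have "v div 22 < 6" "v mod 22 < 22" "v = 22 * (v div 22) + v mod 22"
    using assms by (auto simp: gap_vertices_def)
  then show ?thesis using that by blast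
qed (use that in blast)

lemma connected_gap: "connected_graph gap_vertices gap_edge"
proof (rule connected_graph_root[OF graph_gap, of 132])
  fix v assume "v \<in> gap_vertices"
  then show "gap_edge\<^sup>*\<^sup>* v 132"
  proof (cases rule: gap_vertex_cases)
    case (2 i j)
    note bv = branch_vertex[OF 2(1)]
    have "gap_edge (22 * i) 132" "gap_edge (22 * i + 1) (22 * i)"
         "gap_edge (22 * i + 2) (22 * i + 1)"
      using 2(1) bv(1,2)[of 1] bv(1,2)[of 2] unfolding gap_edge_def by simp_all
    then have *: "gap_edge\<^sup>*\<^sup>* (22 * i) 132" "gap_edge\<^sup>*\<^sup>* (22 * i + 1) 132"
         "gap_edge\<^sup>*\<^sup>* (22 * i + 2) 132"
      by (meson converse_rtranclp_into_rtranclp rtranclp.rtrancl_refl)+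
    have "gap_edge (22 * i + j) (22 * i + 2)" if "j > 2"
      using 2 that bv(1,2)[of 2] bv(1,2)[of j] unfolding gap_edge_def by simp
    then have "gap_edge\<^sup>*\<^sup>* (22 * i + j) 132" if "j > 2"
      using that *(3) by (meson converse_rtranclp_into_rtranclp)
    moreover have "j = 0 \<or> j = 1 \<or> j = 2 \<or> j > 2" by linarith
    ultimately show ?thesis using * unfolding 2(3) by (elim disjE) simp_all
  qed auto
qed (auto simp: gap_vertices_def)

text \<open>An edge stays in one branch or touches the hub, and the hub alone has depth 0. The
  Lipschitz bound for \<open>far_dist\<close> needs nothing more about edges.\<close>

lemma gap_edge_depth:
  assumes "gap_edge a b"
  shows "depth a \<le> depth b + 1 \<and> (a div 22 = b div 22 \<or> depth a = 0 \<or> depth b = 0)"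
proof -
  define ra rb da db where defs: "ra = a mod 22" "rb = b mod 22" "da = a div 22" "db = b div 22"
  have "a = 132 \<and> rb = 0 \<or> b = 132 \<and> ra = 0 \<or>
      da = db \<and> (ra \<ge> 2 \<and> rb \<ge> 2 \<or> rb = Suc ra \<and> rb \<le> 2 \<or> ra = Suc rb \<and> ra \<le> 2)"
    using assms unfolding gap_edge_def defs by blast
  moreover have "a = 132 \<Longrightarrow> ra = 0" "b = 132 \<Longrightarrow> rb = 0"
    by (simp_all add: defs)
  moreover have "a \<le> 132" "b \<le> 132" "a \<noteq> b"
    using assms by (simp_all add: gap_edge_def)
  \<comment> \<open>The hub is alone in its quotient class, so the clause for edges inside a branch
    cannot apply to it.\<close>
  then have "da \<noteq> db" if "a = 132 \<or> b = 132"
    using that unfolding defs by (elim disjE) simp_all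
  ultimately show ?thesis
    unfolding depth_def defs[symmetric] by (elim disjE) auto
qed

lemma gap_edge_sym: "gap_edge a b \<Longrightarrow> gap_edge b a"
  using graph_gap by (auto simp: graph_def)

text \<open>Both formulas in \<open>far_dist\<close> take the value 4 at depth 0, so they fit
  together at the hub, the only place where an edge can enter or leave a branch.\<close>

lemma far_dist_lipschitz:
  assumes "gap_edge a b"
  shows "far_dist i a \<le> far_dist i b + 1"
proof -
  have "depth v \<le> 4" for v by (simp add: depth_def)
  then show ?thesis
    using gap_edge_depth[OF assms] gap_edge_depth[OF gap_edge_sym[OF assms]]
    unfolding far_dist_def by (cases "a div 22 = i"; cases "b div 22 = i") (simp_all, linarith?)
qed

lemma far_client_branch:
  assumes "v \<in> far_clients i"
  shows "v div 22 = i"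
  using assms by (intro div_nat_eqI) (auto simp: far_clients_def)

lemma far_dist_far_client:
  assumes "i < 6" "v \<in> far_clients i"
  shows "far_dist i v = 0" "v \<in> gap_vertices"
proof -
  have "v div 22 = i" "3 \<le> v mod 22" "v < 132"
    using assms far_client_branch[OF assms(2)] div_mult_mod_eq[of v 22]
    unfolding far_clients_def by auto
  then show "far_dist i v = 0" "v \<in> gap_vertices"
    by (simp_all add: far_dist_def depth_def gap_vertices_def)
qed

section \<open>The fractional solution\<close>

lemma sum_gap_vertices:
  fixes f :: "nat \<Rightarrow> real"
  shows "sum f gap_vertices = (\<Sum>i<6. \<Sum>j<22. f (22 * i + j)) + f 132"
proof -
  have "(\<Sum>i<6. \<Sum>j<22. f (22 * i + j)) = (\<Sum>i<6. sum f {i * 22..<i * 22 + 22})"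
    by (simp add: sum.atLeastLessThan_shift_0[of f "_ * 22"] atLeast0LessThan mult.commute comp_def)
  also have "\<dots> = sum f {..<132}"
    using sum.nat_group[of f 22 6] by simp
  finally show ?thesis
    by (simp add: gap_vertices_hub)
qed

lemma gap_y_sum: "sum gap_y gap_vertices = 10"
proof -
  have "gap_y (22 * i + j) = (if j = 2 then 1 else if j = 3 then 1/2 else 0)"
    if "i < 6" "j < 22" for i j
    using branch_vertex[OF that] by (simp add: gap_y_def)
  then have "sum gap_y gap_vertices =
      (\<Sum>i<6::nat. \<Sum>j<22::nat. if j = 2 then 1 else if j = 3 then 1/2 else 0) + 1"
    unfolding sum_gap_vertices by (simp add: gap_y_def)
  also have "\<dots> = 10"
    by (simp add: lessThan_nat_numeral)
  finally show ?thesis .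
qed

lemma gap_x_branch:
  assumes "i < 6" "j < 22"
  shows "gap_x 132 (22 * i + j) = (if j = 0 then 1 else 0)"
    "gap_x (22 * i + j) 132 = 0"
    "\<And>i' j'. i' < 6 \<Longrightarrow> j' < 22 \<Longrightarrow>
       gap_x (22 * i + j) (22 * i' + j') = (if i = i' then gap_share j j' else 0)"
  using assms by (simp_all add: gap_x_def branch_vertex)

lemma gap_x_assigned:
  assumes "v \<in> gap_vertices"
  shows "(\<Sum>u\<in>gap_vertices. gap_x u v) = 1"
  using assms
proof (cases rule: gap_vertex_cases)
  case 1
  then show ?thesis
    unfolding sum_gap_vertices by (simp add: gap_x_branch) (simp add: gap_x_def)
next
  case (2 i j)
  have "(\<Sum>i'<6. \<Sum>j'<22. gap_x (22 * i' + j') v) =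
      (\<Sum>i'<6. if i' = i then \<Sum>j'<22. gap_share j' j else 0)"
    using 2 by (intro sum.cong refl) (auto simp: gap_x_branch)
  also have "\<dots> = (\<Sum>j'<22. gap_share j' j)"
    using 2 by simp
  also have "\<dots> = (if j = 0 then 0 else 1)"
    by (simp add: lessThan_nat_numeral gap_share_def)
  finally show ?thesis
    unfolding sum_gap_vertices using 2 by (simp add: gap_x_branch)
qed

lemma gap_x_capacity:
  assumes "u \<in> gap_vertices"
  shows "(\<Sum>v\<in>gap_vertices. gap_x u v) \<le> real (gap_cap u) * gap_y u"
  using assms
proof (cases rule: gap_vertex_cases)
  case 1
  then show ?thesis
    unfolding sum_gap_vertices
    by (simp add: gap_x_branch) (simp add: gap_x_def gap_cap_def gap_y_def)
next
  case (2 i j)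
  have "(\<Sum>i'<6. \<Sum>j'<22. gap_x u (22 * i' + j')) =
      (\<Sum>i'<6. if i = i' then \<Sum>j'<22. gap_share j j' else 0)"
    using 2 by (intro sum.cong refl) (auto simp: gap_x_branch)
  also have "\<dots> = (\<Sum>j'<22. gap_share j j')"
    using 2 by simp
  also have "\<dots> = (if j = 2 then 14 else if j = 3 then 7 else 0)"
    by (simp add: lessThan_nat_numeral gap_share_def)
  finally show ?thesis
    unfolding sum_gap_vertices using 2 branch_vertex[OF 2(1,2)]
    by (simp add: gap_x_branch gap_cap_def gap_y_def)
qed

lemma gap_x_nonzero_adjacent:
  assumes "u \<in> gap_vertices" "v \<in> gap_vertices" "gap_x u v \<noteq> 0"
  shows "u = v \<or> gap_edge u v"
proof (cases "u = 132")
  case True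
  then show ?thesis
    using assms by (simp add: gap_x_def gap_edge_def gap_vertices_def split: if_splits)
next
  case False
  then have "u div 22 = v div 22" and share: "gap_share (u mod 22) (v mod 22) \<noteq> 0"
    using assms(3) by (simp_all add: gap_x_def split: if_splits)
  \<comment> \<open>A nonzero share occurs only within the clique or from j = 2 to j = 1.\<close>
  moreover from share have "2 \<le> u mod 22 \<and> 2 \<le> v mod 22 \<or> u mod 22 = 2 \<and> v mod 22 = 1"
    unfolding gap_share_def by (simp split: if_splits; linarith)
  ultimately show ?thesis
    using assms(1,2) unfolding gap_edge_def gap_vertices_def by auto
qed

lemma gap_LP1_sol: "LP1_sol True gap_vertices gap_edge gap_cap 10 gap_x gap_y"
  unfolding LP1_sol_def
proof (intro conjI ballI impI)
  fix u v assume uv: "u \<in> gap_vertices" "v \<in> gap_vertices"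
  show "gap_x u v \<le> gap_y u" "0 \<le> gap_x u v"
    unfolding gap_x_def gap_y_def gap_share_def by auto
  assume "gdist gap_vertices gap_edge u v > 1"
  then show "gap_x u v = 0"
    using gap_x_nonzero_adjacent[OF uv] gdist_adjacent_le_1[of gap_edge u v] gdist_refl_le_1 uv
    by (metis leD)
qed (auto simp: gap_y_sum gap_x_capacity gap_x_assigned, auto simp: gap_y_def)

text \<open>Larger capacities relax only constraint (3), because \<open>y\<close> is nonnegative.
  This carries the solution for \<open>gap_cap\<close> over to the constant capacity 14.\<close>

lemma LP1_feasible_mono:
  assumes "LP1_feasible V E L k" "\<And>u. u \<in> V \<Longrightarrow> L u \<le> L' u"
  shows "LP1_feasible V E L' k"
proof -
  obtain x y where "LP1_sol True V E L k x y"
    using assms(1) by (auto simp: LP1_feasible_def)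
  moreover from this have "real (L u) * y u \<le> real (L' u) * y u" if "u \<in> V" for u
    using assms(2)[OF that] that unfolding LP1_sol_def by (intro mult_right_mono) auto
  ultimately have "LP1_sol True V E L' k x y"
    unfolding LP1_sol_def by (meson order_trans)
  then show ?thesis by (auto simp: LP1_feasible_def)
qed

lemma LP1_feasible_imp_soft:
  "LP1_feasible V E L k \<Longrightarrow> soft_LP1_feasible V E L k"
  unfolding LP1_feasible_def soft_LP1_feasible_def LP1_sol_def by blast

section \<open>No integral solution\<close>

text \<open>Counting argument shared by hard and soft centers, with multiplicities \<open>m\<close>.
  The assumption \<open>hub\<close> covers both: a hard solution opens the hub at most once, and a
  soft one of radius 3 sends no far client there.\<close>

lemma no_integral_assignment:
  fixes m \<phi> :: "nat \<Rightarrow> nat"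
  assumes budget: "(\<Sum>u\<in>gap_vertices. m u) \<le> 10"
    and mem: "\<And>v. v \<in> gap_vertices \<Longrightarrow> \<phi> v \<in> gap_vertices"
    and load: "\<And>u. u \<in> gap_vertices \<Longrightarrow> card {v \<in> gap_vertices. \<phi> v = u} \<le> 14 * m u"
    and near: "\<And>i v. i < 6 \<Longrightarrow> v \<in> far_clients i \<Longrightarrow> \<phi> v div 22 = i \<or> \<phi> v = 132"
    and hub: "m 132 \<le> 1 \<or> (\<forall>i<6. \<forall>v\<in>far_clients i. \<phi> v \<noteq> 132)"
  shows False
proof -
  define c where "c i = card {v \<in> far_clients i. \<phi> v = 132}" for i
  define s where "s i = (\<Sum>u\<in>{22 * i..<22 * i + 22}. m u)" for i
  have fin: "finite gap_vertices" by (simp add: gap_vertices_def)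
  \<comment> \<open>A linear consequence of 19 \<le> c + 14 s over the integers: s = 0 gives c \<ge>
    19, s = 1 gives c \<ge> 5, and s \<ge> 2 suffices alone. Rounding here is what the fractional
    solution escapes.\<close>
  have key: "10 \<le> c i + 5 * s i" if i: "i < 6" for i
  proof -
    have "card {v \<in> far_clients i. \<phi> v div 22 = i}
        \<le> card (\<Union>u\<in>{22 * i..<22 * i + 22}. {v \<in> gap_vertices. \<phi> v = u})"
      using far_dist_far_client(2)[OF i] fin
      by (intro card_mono) (auto simp: dividend_less_div_times mult.commute)
    also have "\<dots> \<le> (\<Sum>u\<in>{22 * i..<22 * i + 22}. card {v \<in> gap_vertices. \<phi> v = u})"
      by (rule card_UN_le) simp
    also have "\<dots> \<le> (\<Sum>u\<in>{22 * i..<22 * i + 22}. 14 * m u)"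
      using i by (intro sum_mono load) (auto simp: gap_vertices_def)
    also have "\<dots> = 14 * s i"
      by (simp add: s_def sum_distrib_left)
    finally have near_load: "card {v \<in> far_clients i. \<phi> v div 22 = i} \<le> 14 * s i" .
    have "19 = card (far_clients i)"
      by (simp add: far_clients_def)
    also have "\<dots> \<le> card ({v \<in> far_clients i. \<phi> v = 132} \<union> {v \<in> far_clients i. \<phi> v div 22 = i})"
      using near[OF i] by (intro card_mono) (simp add: far_clients_def, blast)
    also have "\<dots> \<le> c i + card {v \<in> far_clients i. \<phi> v div 22 = i}"
      unfolding c_def by (rule card_Un_le)
    finally have "19 \<le> c i + 14 * s i" using near_load by linarith
    then show ?thesis by (cases "s i = 0"; cases "s i = 1") auto
  qed
  have "(\<Sum>i<6::nat. 10) \<le> (\<Sum>i<6. c i + 5 * s i)"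
    using key by (intro sum_mono) auto
  then have total: "60 \<le> (\<Sum>i<6. c i) + 5 * (\<Sum>i<6. s i)"
    by (simp add: sum.distrib sum_distrib_left)
  have "(\<Sum>i<6. s i) = sum m {..<132}"
    unfolding s_def using sum.nat_group[of m 22 6] by (simp add: mult.commute)
  then have used: "(\<Sum>i<6. s i) + m 132 \<le> 10"
    using budget by (simp add: gap_vertices_hub)
  have "(\<Sum>i<6. c i) = card (\<Union>i<6. {v \<in> far_clients i. \<phi> v = 132})"
    unfolding c_def
  proof (rule card_UN_disjoint[symmetric])
    show "\<forall>i\<in>{..<6}. \<forall>j\<in>{..<6}. i \<noteq> j \<longrightarrow>
        {v \<in> far_clients i. \<phi> v = 132} \<inter> {v \<in> far_clients j. \<phi> v = 132} = {}"
      using far_client_branch by blast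
  qed (simp_all add: far_clients_def)
  also have "\<dots> \<le> card {v \<in> gap_vertices. \<phi> v = 132}"
    using far_dist_far_client(2) fin by (intro card_mono) auto
  also have "\<dots> \<le> 14 * m 132"
    by (rule load) (simp add: gap_vertices_def)
  finally have hub_load: "(\<Sum>i<6. c i) \<le> 14 * m 132" .
  from hub show False
  proof
    assume "m 132 \<le> 1"
    then consider "m 132 = 0" | "m 132 = 1" by linarith
    \<comment> \<open>An open hub leaves 9 facilities to the branches and takes at most 14 far
      clients: 14 + 5 * 9 = 59 < 60. A closed hub gives at most 5 * 10 = 50.\<close>
    then show False using total used hub_load by cases auto
  next
    assume "\<forall>i<6. \<forall>v\<in>far_clients i. \<phi> v \<noteq> 132"
    then have "c i = 0" if "i < 6" for i
      using that unfolding c_def card_eq_0_iff by blast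
    then have "(\<Sum>i<6. c i) = 0" by simp
    then show False using total used by linarith
  qed
qed

lemma gpow_far_dist:
  assumes "i < 6" "v \<in> far_clients i" "w = v \<or> gpow gap_vertices gap_edge d w v"
  shows "far_dist i w \<le> d"
  using assms far_dist_far_client(1)[OF assms(1,2)]
    gdist_lipschitz[of gap_edge "far_dist i" gap_vertices w v d] far_dist_lipschitz
  by (auto simp: gpow_def)

text \<open>The assumption \<open>near\<close> isolates the dependence on the radius, so that radius
  4 with constant capacity and radius 6 with \<open>gap_cap\<close> share one proof.\<close>

lemma no_hard_kcenter:
  assumes cap: "\<And>u. u \<in> gap_vertices \<Longrightarrow> L u \<le> 14"
    and near: "\<And>i u. i < 6 \<Longrightarrow> u \<in> gap_vertices \<Longrightarrow> L u > 0 \<Longrightarrow> far_dist i u \<le> d \<Longrightarrow>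
      u div 22 = i \<or> u = 132"
  shows "\<not> hard_kcenter_sol gap_vertices (gpow gap_vertices gap_edge d) L 10"
proof
  assume "hard_kcenter_sol gap_vertices (gpow gap_vertices gap_edge d) L 10"
  then obtain S \<phi> where S: "S \<subseteq> gap_vertices" "card S \<le> 10"
    and \<phi>: "\<And>v. v \<in> gap_vertices \<Longrightarrow> \<phi> v \<in> S \<and> (\<phi> v = v \<or> gpow gap_vertices gap_edge d (\<phi> v) v)"
    and load: "\<And>u. u \<in> S \<Longrightarrow> card {v \<in> gap_vertices. \<phi> v = u} \<le> L u"
    unfolding hard_kcenter_sol_def by blast
  have fin: "finite gap_vertices" by (simp add: gap_vertices_def)
  define m :: "nat \<Rightarrow> nat" where "m u = (if u \<in> S then 1 else 0)" for u
  show False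
  proof (rule no_integral_assignment[of m \<phi>])
    show "(\<Sum>u\<in>gap_vertices. m u) \<le> 10"
      using S fin by (simp add: m_def sum.If_cases Int_absorb1)
    show "m 132 \<le> 1 \<or> (\<forall>i<6. \<forall>v\<in>far_clients i. \<phi> v \<noteq> 132)"
      by (simp add: m_def)
  next
    fix u assume "u \<in> gap_vertices"
    show "card {v \<in> gap_vertices. \<phi> v = u} \<le> 14 * m u"
    proof (cases "u \<in> S")
      case True
      then show ?thesis
        using load[OF True] cap[OF \<open>u \<in> gap_vertices\<close>] by (simp add: m_def)
    next
      case False
      then have "card {v \<in> gap_vertices. \<phi> v = u} = 0"
        using \<phi> unfolding card_eq_0_iff by blast
      then show ?thesis by simp
    qed
  next
    fix i v assume iv: "i < 6" "v \<in> far_clients i"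
    note v = far_dist_far_client(2)[OF iv]
    \<comment> \<open>The client \<open>v\<close> itself lies in this fibre, so the facility serving
      it has positive capacity and \<open>near\<close> applies.\<close>
    have "card {w \<in> gap_vertices. \<phi> w = \<phi> v} > 0"
      using v fin by (auto simp: card_gt_0_iff)
    then have "L (\<phi> v) > 0" using load[of "\<phi> v"] \<phi>[OF v] by linarith
    then show "\<phi> v div 22 = i \<or> \<phi> v = 132"
      using near[OF iv(1)] gpow_far_dist[OF iv] \<phi>[OF v] S(1) by blast
  qed (use \<phi> S in blast)
qed

lemma no_soft_kcenter:
  "\<not> soft_kcenter_sol gap_vertices (gpow gap_vertices gap_edge 3) (\<lambda>_. 14) 10"
proof
  assume "soft_kcenter_sol gap_vertices (gpow gap_vertices gap_edge 3) (\<lambda>_. 14) 10"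
  then obtain m \<phi> where budget: "(\<Sum>u\<in>gap_vertices. m u) \<le> 10"
    and \<phi>: "\<And>v. v \<in> gap_vertices \<Longrightarrow>
      \<phi> v \<in> gap_vertices \<and> (\<phi> v = v \<or> gpow gap_vertices gap_edge 3 (\<phi> v) v)"
    and load: "\<And>u. u \<in> gap_vertices \<Longrightarrow> card {v \<in> gap_vertices. \<phi> v = u} \<le> 14 * m u"
    unfolding soft_kcenter_sol_def by blast
  \<comment> \<open>Outside branch \<open>i\<close> the value of \<open>far_dist\<close> is at least
    4, so radius 3 excludes even the hub, whose multiplicity is not bounded by 1 here.\<close>
  have near: "\<phi> v div 22 = i" if "i < 6" "v \<in> far_clients i" for i v
    using gpow_far_dist[OF that, of "\<phi> v" 3] \<phi>[OF far_dist_far_client(2)[OF that]]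
    by (auto simp: far_dist_def split: if_splits)
  then have "\<phi> v \<noteq> 132" if "i < 6" "v \<in> far_clients i" for i v
    using that by fastforce
  with near show False
    by (intro no_integral_assignment[OF budget _ load]) (use \<phi> in auto)
qed

theorem theorem6:
  shows "(\<exists>V E L k c. connected_graph V E \<and> (\<forall>u\<in>V. L u = c) \<and> (k::nat) > 0 \<and>
            LP1_feasible V E L k \<and> \<not> hard_kcenter_sol V (gpow V E 4) L k)
       \<and> (\<exists>V E L k c. connected_graph V E \<and> (\<forall>u\<in>V. L u = c) \<and> (k::nat) > 0 \<and>
            soft_LP1_feasible V E L k \<and> \<not> soft_kcenter_sol V (gpow V E 3) L k)
       \<and> (\<exists>V E L k. connected_graph V E \<and>
            (\<forall>u\<in>V. \<forall>v\<in>V. L u \<noteq> 0 \<and> L v \<noteq> 0 \<longrightarrow> L u = L v) \<and> (k::nat) > 0 \<and>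
            LP1_feasible V E L k \<and> \<not> hard_kcenter_sol V (gpow V E 6) L k)"
proof -
  have LP: "LP1_feasible gap_vertices gap_edge gap_cap 10"
    using gap_LP1_sol by (auto simp: LP1_feasible_def)
  have LP_uniform: "LP1_feasible gap_vertices gap_edge (\<lambda>_. 14) 10"
    by (rule LP1_feasible_mono[OF LP]) (simp add: gap_cap_def)
  \<comment> \<open>Outside the branch \<open>far_dist\<close> is 4 plus the depth, so within radius
    4 only the hub remains.\<close>
  have hard4: "\<not> hard_kcenter_sol gap_vertices (gpow gap_vertices gap_edge 4) (\<lambda>_. 14) 10"
    by (rule no_hard_kcenter) (simp_all add: far_dist_def depth_def split: if_splits)
  \<comment> \<open>Apart from the hub, positive capacity occurs only at depth 3 or 4, hence at
    distance at least 7 from the far clients of another branch.\<close>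
  have hard6: "\<not> hard_kcenter_sol gap_vertices (gpow gap_vertices gap_edge 6) gap_cap 10"
    by (rule no_hard_kcenter) (auto simp add: far_dist_def depth_def gap_cap_def split: if_splits)
  have cap: "\<forall>u\<in>gap_vertices. \<forall>v\<in>gap_vertices.
      gap_cap u \<noteq> 0 \<and> gap_cap v \<noteq> 0 \<longrightarrow> gap_cap u = gap_cap v"
    by (simp add: gap_cap_def)
  show ?thesis
  proof (intro conjI)
    show "\<exists>V E L k c. connected_graph V E \<and> (\<forall>u\<in>V. L u = c) \<and> (k::nat) > 0 \<and>
        LP1_feasible V E L k \<and> \<not> hard_kcenter_sol V (gpow V E 4) L k"
      using connected_gap LP_uniform hard4
      by (intro exI[of _ gap_vertices] exI[of _ gap_edge] exI[of _ "\<lambda>_. 14"] exI[of _ 10]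
          exI[of _ 14]) simp
    show "\<exists>V E L k c. connected_graph V E \<and> (\<forall>u\<in>V. L u = c) \<and> (k::nat) > 0 \<and>
        soft_LP1_feasible V E L k \<and> \<not> soft_kcenter_sol V (gpow V E 3) L k"
      using connected_gap LP1_feasible_imp_soft[OF LP_uniform] no_soft_kcenter
      by (intro exI[of _ gap_vertices] exI[of _ gap_edge] exI[of _ "\<lambda>_. 14"] exI[of _ 10]
          exI[of _ 14]) simp
    show "\<exists>V E L k. connected_graph V E \<and>
        (\<forall>u\<in>V. \<forall>v\<in>V. L u \<noteq> 0 \<and> L v \<noteq> 0 \<longrightarrow> L u = L v) \<and> (k::nat) > 0 \<and>
        LP1_feasible V E L k \<and> \<not> hard_kcenter_sol V (gpow V E 6) L k"
      using connected_gap cap LP hard6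
      by (intro exI[of _ gap_vertices] exI[of _ gap_edge] exI[of _ gap_cap] exI[of _ 10]) simp
  qed
qed

end
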